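(* Let $l \xrightarrow{c} r$ be a conditional term rewrite rule, let $t$ be a term, let $p$ be a position within $t$, and let $\sigma$ be a non-conflicting substitution with $\mathcal{D}om(\sigma)\subseteq \mathcal{V}ar(l)$. If $l \xrightarrow{c} r$ is valid and WD-preserving, then the following two well-defined sequents are provable: $$\sigma(c)~\vdash_{\mathcal{D}}~t[\sigma(l)]_p = t[\sigma(r)]_p,$$ $$\mathcal{D}(t[\sigma(l)]_p),\ \sigma(c)~\vdash_{\mathcal{D}}~\mathcal{D}(t[\sigma(r)]_p).$$
   Context: Fix a first-order signature $\Sigma$: a set $V$ of variables, a set $F$ of function symbols and a set $P$ of predicate symbols, each with an arity. Terms: every variable is a term; if $f\in F$ has arity $n$ and $e_1,\dots,e_n$ are terms then $f(e_1,\dots,e_n)$ is a term. Formulas: $\bot$; $p(t_1,\dots,t_n)$ for $p\in P$ of arity $n$; $t_1=t_2$; $\varphi\land\psi$; $\lnot\varphi$; $\forall x\cdot\varphi$ ($x\in V$); the other connectives ($\lor,\Rightarrow,\Leftrightarrow,\exists,\top$) are the usual abbreviations. $\mathcal{V}ar(e)$ is the set of free variables of a term or formula $e$. Well-definedness operator $\mathcal{D}$ (a syntactic map from terms and formulas to formulas): $\mathcal{D}(x)=\top$ for $x\in V$; $\mathcal{D}(f(t_1,\dots,t_n))=\bigwedge_{i}\mathcal{D}(t_i)\land C^f_{t_1,\dots,t_n}$, where $C^f_{t_1,\dots,t_n}$ is a given formula expressing that $(t_1,\dots,t_n)$ lies in the domain of $f$; $\mathcal{D}(p(t_1,\dots,t_n))=\bigwedge_i\mathcal{D}(t_i)$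 (predicates are total); $\mathcal{D}(t_1=t_2)=\mathcal{D}(t_1)\land\mathcal{D}(t_2)$; $\mathcal{D}(\bot)=\top$; $\mathcal{D}(\lnot\varphi)=\mathcal{D}(\varphi)$; $\mathcal{D}(\varphi\land\psi)=(\mathcal{D}(\varphi)\land\mathcal{D}(\psi))\lor(\mathcal{D}(\varphi)\land\lnot\varphi)\lor(\mathcal{D}(\psi)\land\lnot\psi)$; $\mathcal{D}(\forall x\cdot\varphi)=(\forall x\cdot\mathcal{D}(\varphi))\lor(\exists x\cdot\mathcal{D}(\varphi)\land\lnot\varphi)$. A well-defined sequent $H\vdash_{\mathcal{D}} G$ ($H$ a finite list of formulas, $G$ a formula) stands for the classical sequent $\mathcal{D}(H),\mathcal{D}(G),H\vdash G$. It is provable if derivable in the calculus FoPCe$_{\mathcal{D}}$, whose rules (all sequents being $\vdash_{\mathcal{D}}$-sequents) are: hyp ($H,P\vdash_{\mathcal{D}}P$); mon (from $H\vdash_{\mathcal{D}}Q$ infer $H,P\vdash_{\mathcal{D}}Q$); contr (from $H,\lnot Q\vdash_{\mathcal{D}}\bot$ infer $H\vdash_{\mathcal{D}}Q$); $\bot$hyp ($H,\bot\vdash_{\mathcal{D}}P$); $\lnot$goal (from $H,P\vdash_{\mathcal{D}}\bot$ infer $H\vdash_{\mathcal{D}}\lnot P$); $\lnot$hyp (from $H\vdash_{\mathcal{D}}P$ infer $H,\lnot P\vdash_{\mathcal{D}}Q$); $\land$goal (from $H\vdash_{\mathcal{D}}P$ and $H\vdash_{\mathcal{D}}Q$ infer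 $H\vdash_{\mathcal{D}}P\land Q$); $\land$hyp (from $H,P,Q\vdash_{\mathcal{D}}R$ infer $H,P\land Q\vdash_{\mathcal{D}}R$); $\forall$goal (if $x$ not free in $H$, from $H\vdash_{\mathcal{D}}P$ infer $H\vdash_{\mathcal{D}}\forall x\cdot P$); $=$goal ($H\vdash_{\mathcal{D}}E=E$); $=$hyp (from $H\vdash_{\mathcal{D}}[x:=E]P$ infer $H,E=F\vdash_{\mathcal{D}}[x:=F]P$); cut (from $H\vdash_{\mathcal{D}}\mathcal{D}(P)$, $H\vdash_{\mathcal{D}}P$ and $H,P\vdash_{\mathcal{D}}Q$ infer $H\vdash_{\mathcal{D}}Q$); $\forall$hyp (from $H\vdash_{\mathcal{D}}\mathcal{D}(E)$ and $H,[x:=E]P\vdash_{\mathcal{D}}Q$ infer $H,\forall x\cdot P\vdash_{\mathcal{D}}Q$); here $[x:=E]P$ is substitution of $E$ for free occurrences of $x$. Substitutions $\sigma$ map variables to terms with finite $\mathcal{D}om(\sigma)=\{x\mid\sigma(x)\neq x\}$ and $\mathcal{R}an(\sigma)=\{\sigma(x)\mid x\in\mathcal{D}om(\sigma)\}$; $\sigma$ is applied simultaneously. $\sigma$ is non-conflicting if $\bigl(\bigcup_{t\in\mathcal{R}an(\sigma)}\mathcal{V}ar(t)\bigr)\cap\mathcal{D}om(\sigma)=\emptyset$. For a position $p$ in a term/formula $F$, $F|_p$ is the subterm at $p$ and $F[s]_p$ is $F$ with $F|_p$ replaced by $s$. A conditional identity is a triple $(l,c,r)$ with $l,r$ terms and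 $c$ a formula; it is valid iff $c\vdash_{\mathcal{D}} l=r$ is provable. A conditional term rewrite rule $l\xrightarrow{c} r$ is a conditional identity $(l,c,r)$ with $l$ not a variable, $\mathcal{V}ar(c)\subseteq\mathcal{V}ar(l)$ and $\mathcal{V}ar(r)\subseteq\mathcal{V}ar(l)$. It is WD-preserving iff $\mathcal{D}(l),c\vdash_{\mathcal{D}}\mathcal{D}(r)$ is provable.
   Formalization: The calculus FoPCe_D is extended by one rule, from D(H), D(G), H ⊢_D G infer H ⊢_D G, reflecting what ⊢_D stands for; with only the listed rules the first sequent can fail to be derivable (e.g. c = ∀y·g(y)=h(y), l = g(x), r = h(x), σ(x) = f(z), f nowhere defined). *)

theory Defs
  imports Main
begin

text \<open>
  Terms and formulas are taken modulo renaming of bound variables by means of de Bruijn indices: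
  the variables are the natural numbers, and under \<open>n\<close> quantifiers index \<open>i \<ge> n\<close> denotes the
  variable \<open>i - n\<close>, while an index below \<open>n\<close> is bound.
\<close>

datatype 'f tm = Var nat | Fun 'f "'f tm list"

datatype ('f, 'p) fm =
    Falsity
  | Pred 'p "'f tm list"
  | Eq "'f tm" "'f tm"
  | And "('f, 'p) fm" "('f, 'p) fm"
  | Neg "('f, 'p) fm"
  | All "('f, 'p) fm"

abbreviation Truth :: "('f, 'p) fm" where
  "Truth \<equiv> Neg Falsity"

abbreviation Or :: "('f, 'p) fm \<Rightarrow> ('f, 'p) fm \<Rightarrow> ('f, 'p) fm" where
  "Or \<phi> \<psi> \<equiv> Neg (And (Neg \<phi>) (Neg \<psi>))"

abbreviation Ex :: "('f, 'p) fm \<Rightarrow> ('f, 'p) fm" where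
  "Ex \<phi> \<equiv> Neg (All (Neg \<phi>))"

definition conjs :: "('f, 'p) fm list \<Rightarrow> ('f, 'p) fm" where
  "conjs \<phi>s = foldr And \<phi>s Truth"


primrec fv_tm :: "'f tm \<Rightarrow> nat set" where
  "fv_tm (Var x) = {x}"
| "fv_tm (Fun f ts) = \<Union> (set (map fv_tm ts))"

primrec fv_fm :: "('f, 'p) fm \<Rightarrow> nat set" where
  "fv_fm Falsity = {}"
| "fv_fm (Pred p ts) = \<Union> (set (map fv_tm ts))"
| "fv_fm (Eq s t) = fv_tm s \<union> fv_tm t"
| "fv_fm (And \<phi> \<psi>) = fv_fm \<phi> \<union> fv_fm \<psi>"
| "fv_fm (Neg \<phi>) = fv_fm \<phi>"
| "fv_fm (All \<phi>) = {x. Suc x \<in> fv_fm \<phi>}"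


primrec subst_tm :: "(nat \<Rightarrow> 'f tm) \<Rightarrow> 'f tm \<Rightarrow> 'f tm" where
  "subst_tm \<sigma> (Var x) = \<sigma> x"
| "subst_tm \<sigma> (Fun f ts) = Fun f (map (subst_tm \<sigma>) ts)"

definition lift_subst :: "(nat \<Rightarrow> 'f tm) \<Rightarrow> nat \<Rightarrow> 'f tm" where
  "lift_subst \<sigma> i = (case i of 0 \<Rightarrow> Var 0 | Suc x \<Rightarrow> subst_tm (\<lambda>y. Var (Suc y)) (\<sigma> x))"

primrec subst_fm :: "(nat \<Rightarrow> 'f tm) \<Rightarrow> ('f, 'p) fm \<Rightarrow> ('f, 'p) fm" where
  "subst_fm \<sigma> Falsity = Falsity"
| "subst_fm \<sigma> (Pred p ts) = Pred p (map (subst_tm \<sigma>) ts)"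
| "subst_fm \<sigma> (Eq s t) = Eq (subst_tm \<sigma> s) (subst_tm \<sigma> t)"
| "subst_fm \<sigma> (And \<phi> \<psi>) = And (subst_fm \<sigma> \<phi>) (subst_fm \<sigma> \<psi>)"
| "subst_fm \<sigma> (Neg \<phi>) = Neg (subst_fm \<sigma> \<phi>)"
| "subst_fm \<sigma> (All \<phi>) = All (subst_fm (lift_subst \<sigma>) \<phi>)"

definition shift_fm :: "('f, 'p) fm \<Rightarrow> ('f, 'p) fm" where
  "shift_fm \<phi> = subst_fm (\<lambda>x. Var (Suc x)) \<phi>"

text \<open>If \<open>All P\<close> represents \<open>\<forall>x. P\<close>, then \<open>inst_fm E P\<close> represents \<open>[x := E]P\<close>.\<close>

definition inst_fm :: "'f tm \<Rightarrow> ('f, 'p) fm \<Rightarrow> ('f, 'p) fm" where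
  "inst_fm E \<phi> = subst_fm (\<lambda>i. case i of 0 \<Rightarrow> E | Suc x \<Rightarrow> Var x) \<phi>"


text \<open>
  The symbols of the signature are those on which the arity maps are defined.
  The formula \<open>dom_cond S f\<close> describes the domain of \<open>f\<close>, with the variables \<open>0, \<dots>, n - 1\<close>
  standing for the arguments of \<open>f\<close>.
\<close>

record ('f, 'p) signature =
  fun_arity :: "'f \<Rightarrow> nat option"
  pred_arity :: "'p \<Rightarrow> nat option"
  dom_cond :: "'f \<Rightarrow> ('f, 'p) fm"

fun wf_tm :: "('f, 'p) signature \<Rightarrow> 'f tm \<Rightarrow> bool" where
  "wf_tm S (Var x) \<longleftrightarrow> True"
| "wf_tm S (Fun f ts) \<longleftrightarrow> fun_arity S f = Some (length ts) \<and> list_all (wf_tm S) ts"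

primrec wf_fm :: "('f, 'p) signature \<Rightarrow> ('f, 'p) fm \<Rightarrow> bool" where
  "wf_fm S Falsity \<longleftrightarrow> True"
| "wf_fm S (Pred p ts) \<longleftrightarrow> pred_arity S p = Some (length ts) \<and> list_all (wf_tm S) ts"
| "wf_fm S (Eq s t) \<longleftrightarrow> wf_tm S s \<and> wf_tm S t"
| "wf_fm S (And \<phi> \<psi>) \<longleftrightarrow> wf_fm S \<phi> \<and> wf_fm S \<psi>"
| "wf_fm S (Neg \<phi>) \<longleftrightarrow> wf_fm S \<phi>"
| "wf_fm S (All \<phi>) \<longleftrightarrow> wf_fm S \<phi>"

definition wf_signature :: "('f, 'p) signature \<Rightarrow> bool" where
  "wf_signature S \<longleftrightarrow>
    (\<forall>f n. fun_arity S f = Some n \<longrightarrow>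
      wf_fm S (dom_cond S f) \<and> fv_fm (dom_cond S f) \<subseteq> {..<n})"

definition dom_cond_at :: "('f, 'p) signature \<Rightarrow> 'f \<Rightarrow> 'f tm list \<Rightarrow> ('f, 'p) fm" where
  "dom_cond_at S f ts = subst_fm (\<lambda>i. if i < length ts then ts ! i else Var i) (dom_cond S f)"


primrec wd_tm :: "('f, 'p) signature \<Rightarrow> 'f tm \<Rightarrow> ('f, 'p) fm" where
  "wd_tm S (Var x) = Truth"
| "wd_tm S (Fun f ts) = And (conjs (map (wd_tm S) ts)) (dom_cond_at S f ts)"

primrec wd_fm :: "('f, 'p) signature \<Rightarrow> ('f, 'p) fm \<Rightarrow> ('f, 'p) fm" where
  "wd_fm S Falsity = Truth"
| "wd_fm S (Pred p ts) = conjs (map (wd_tm S) ts)"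
| "wd_fm S (Eq s t) = And (wd_tm S s) (wd_tm S t)"
| "wd_fm S (And \<phi> \<psi>) =
     Or (Or (And (wd_fm S \<phi>) (wd_fm S \<psi>)) (And (wd_fm S \<phi>) (Neg \<phi>))) (And (wd_fm S \<psi>) (Neg \<psi>))"
| "wd_fm S (Neg \<phi>) = wd_fm S \<phi>"
| "wd_fm S (All \<phi>) = Or (All (wd_fm S \<phi>)) (Ex (And (wd_fm S \<phi>) (Neg \<phi>)))"


text \<open>
  \<open>provable S H G\<close>: the well-defined sequent \<open>H \<turnstile>\<^sub>D G\<close> is provable. A list of hypotheses \<open>H, P\<close>
  is written \<open>P # H\<close>. In \<open>all_goal\<close>, shifting \<open>H\<close> makes the generalised variable fresh for \<open>H\<close>.

  The rule \<open>unfold\<close> expresses that \<open>H \<turnstile>\<^sub>D G\<close> stands for the sequent with hypotheses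
  \<open>D(H), D(G), H\<close> and goal \<open>G\<close>; the converse direction is an instance of \<open>mon\<close>. All other rules are
  classically sound when the hypotheses \<open>D(H), D(G)\<close> are dropped, so without \<open>unfold\<close> these would
  never be available: not even \<open>p(f(x)) \<turnstile>\<^sub>D D(f(x))\<close> would be derivable in general.
\<close>

inductive provable :: "('f, 'p) signature \<Rightarrow> ('f, 'p) fm list \<Rightarrow> ('f, 'p) fm \<Rightarrow> bool"
  for S :: "('f, 'p) signature" where
  hyp: "list_all (wf_fm S) H \<Longrightarrow> wf_fm S P \<Longrightarrow> provable S (P # H) P"
| mon: "provable S H Q \<Longrightarrow> wf_fm S P \<Longrightarrow> provable S (P # H) Q"
| contr: "provable S (Neg Q # H) Falsity \<Longrightarrow> provable S H Q"
| falsity_hyp: "list_all (wf_fm S) H \<Longrightarrow> wf_fm S P \<Longrightarrow> provable S (Falsity # H) P"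
| neg_goal: "provable S (P # H) Falsity \<Longrightarrow> provable S H (Neg P)"
| neg_hyp: "provable S H P \<Longrightarrow> wf_fm S Q \<Longrightarrow> provable S (Neg P # H) Q"
| and_goal: "provable S H P \<Longrightarrow> provable S H Q \<Longrightarrow> provable S H (And P Q)"
| and_hyp: "provable S (Q # P # H) R \<Longrightarrow> provable S (And P Q # H) R"
| all_goal: "provable S (map shift_fm H) P \<Longrightarrow> provable S H (All P)"
| eq_goal: "list_all (wf_fm S) H \<Longrightarrow> wf_tm S E \<Longrightarrow> provable S H (Eq E E)"
| eq_hyp: "provable S H (subst_fm (Var(x := E)) P) \<Longrightarrow> wf_tm S E \<Longrightarrow> wf_tm S F \<Longrightarrow>
     provable S (Eq E F # H) (subst_fm (Var(x := F)) P)"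
| cut: "provable S H (wd_fm S P) \<Longrightarrow> provable S H P \<Longrightarrow> provable S (P # H) Q \<Longrightarrow> provable S H Q"
| all_hyp: "provable S H (wd_tm S E) \<Longrightarrow> provable S (inst_fm E P # H) Q \<Longrightarrow> wf_tm S E \<Longrightarrow>
     provable S (All P # H) Q"
| unfold: "provable S (map (wd_fm S) H @ wd_fm S G # H) G \<Longrightarrow> provable S H G"


definition Dom :: "(nat \<Rightarrow> 'f tm) \<Rightarrow> nat set" where
  "Dom \<sigma> = {x. \<sigma> x \<noteq> Var x}"

definition Ran :: "(nat \<Rightarrow> 'f tm) \<Rightarrow> 'f tm set" where
  "Ran \<sigma> = \<sigma> ` Dom \<sigma>"

definition substitution :: "('f, 'p) signature \<Rightarrow> (nat \<Rightarrow> 'f tm) \<Rightarrow> bool" where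
  "substitution S \<sigma> \<longleftrightarrow> finite (Dom \<sigma>) \<and> (\<forall>x. wf_tm S (\<sigma> x))"

definition non_conflicting :: "(nat \<Rightarrow> 'f tm) \<Rightarrow> bool" where
  "non_conflicting \<sigma> \<longleftrightarrow> (\<Union>t \<in> Ran \<sigma>. fv_tm t) \<inter> Dom \<sigma> = {}"


text \<open>A position is a list of argument indices, counted from \<open>0\<close>.\<close>

primrec positions :: "'f tm \<Rightarrow> nat list set" where
  "positions (Var x) = {[]}"
| "positions (Fun f ts) =
     insert [] {i # p | i p. i < length ts \<and> p \<in> map positions ts ! i}"

fun replace_at :: "'f tm \<Rightarrow> nat list \<Rightarrow> 'f tm \<Rightarrow> 'f tm" where
  "replace_at t [] s = s"
| "replace_at (Fun f ts) (i # p) s = Fun f (ts[i := replace_at (ts ! i) p s])"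
| "replace_at (Var x) (i # p) s = Var x"


type_synonym ('f, 'p) triple = "'f tm \<times> ('f, 'p) fm \<times> 'f tm"

fun conditional_identity :: "('f, 'p) signature \<Rightarrow> ('f, 'p) triple \<Rightarrow> bool" where
  "conditional_identity S (l, c, r) \<longleftrightarrow> wf_tm S l \<and> wf_fm S c \<and> wf_tm S r"

fun valid :: "('f, 'p) signature \<Rightarrow> ('f, 'p) triple \<Rightarrow> bool" where
  "valid S (l, c, r) \<longleftrightarrow> provable S [c] (Eq l r)"

fun rewrite_rule :: "('f, 'p) signature \<Rightarrow> ('f, 'p) triple \<Rightarrow> bool" where
  "rewrite_rule S (l, c, r) \<longleftrightarrow>
    conditional_identity S (l, c, r) \<and> (\<nexists>x. l = Var x) \<and>
    fv_fm c \<subseteq> fv_tm l \<and> fv_tm r \<subseteq> fv_tm l"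

fun wd_preserving :: "('f, 'p) signature \<Rightarrow> ('f, 'p) triple \<Rightarrow> bool" where
  "wd_preserving S (l, c, r) \<longleftrightarrow> provable S [c, wd_tm S l] (wd_tm S r)"

end

theory Submission
  imports Defs
begin

text \<open>
  The argument is syntactic: since the domain conditions may themselves be ill-defined, \<open>provable\<close>
  need not agree with a semantic notion of entailment. Provability is closed under a substitution
  \<open>\<sigma>\<close> once all \<open>wd_tm S (\<sigma> x)\<close> are available as hypotheses. As the domain of \<open>\<sigma>\<close> is contained in
  \<open>fv_tm l\<close>, these are conjuncts of the well-definedness of \<open>\<sigma>(l)\<close>, which in turn is a conjunct
  of that of \<open>t[\<sigma>(l)]\<^sub>p\<close>. Hence validity and WD-preservation carry over to \<open>\<sigma>(l)\<close> and
  \<open>\<sigma>(r)\<close>, and equality reasoning lifts them along the position.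
\<close>

section \<open>Substitution\<close>

lemma subst_tm_comp:
  "subst_tm \<tau> (subst_tm \<sigma> t) = subst_tm (\<lambda>x. subst_tm \<tau> (\<sigma> x)) t"
  by (induction t) auto

lemma lift_subst_comp:
  "(\<lambda>x. subst_tm (lift_subst \<tau>) (lift_subst \<sigma> x)) = lift_subst (\<lambda>x. subst_tm \<tau> (\<sigma> x))"
  by (rule ext) (auto simp: lift_subst_def subst_tm_comp split: nat.split)

lemma subst_fm_comp:
  "subst_fm \<tau> (subst_fm \<sigma> \<phi>) = subst_fm (\<lambda>x. subst_tm \<tau> (\<sigma> x)) \<phi>"
  by (induction \<phi> arbitrary: \<sigma> \<tau>) (auto simp: subst_tm_comp lift_subst_comp)

lemma subst_tm_cong: "(\<forall>x \<in> fv_tm t. \<sigma> x = \<tau> x) \<Longrightarrow> subst_tm \<sigma> t = subst_tm \<tau> t"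
  by (induction t) auto

lemma subst_fm_cong: "(\<forall>x \<in> fv_fm \<phi>. \<sigma> x = \<tau> x) \<Longrightarrow> subst_fm \<sigma> \<phi> = subst_fm \<tau> \<phi>"
proof (induction \<phi> arbitrary: \<sigma> \<tau>)
  case (Pred p ts)
  then show ?case by (auto intro!: subst_tm_cong)
next
  case (Eq s t)
  then show ?case by (auto intro!: subst_tm_cong)
next
  case (And \<phi> \<psi>)
  then show ?case using And.IH[of \<sigma> \<tau>] by simp
next
  case (Neg \<phi>)
  then show ?case using Neg.IH[of \<sigma> \<tau>] by simp
next
  case (All \<phi>)
  have "subst_fm (lift_subst \<sigma>) \<phi> = subst_fm (lift_subst \<tau>) \<phi>"
    by (rule All.IH) (use All.prems in \<open>auto simp: lift_subst_def split: nat.split\<close>)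
  then show ?case by simp
qed auto

lemma subst_tm_Var: "subst_tm Var t = t"
  by (induction t) (auto simp: map_idI)

lemma lift_subst_Var: "lift_subst Var = Var"
  by (rule ext) (auto simp: lift_subst_def split: nat.split)

lemma subst_fm_Var: "subst_fm Var \<phi> = \<phi>"
  by (induction \<phi>) (auto simp: lift_subst_Var subst_tm_Var map_idI)

lemma subst_tm_fresh: "z \<notin> fv_tm t \<Longrightarrow> subst_tm (Var(z := s)) t = t"
  using subst_tm_cong[of t "Var(z := s)" Var] by (metis fun_upd_apply subst_tm_Var)

lemma shift_subst: "subst_fm (lift_subst \<sigma>) (shift_fm \<phi>) = shift_fm (subst_fm \<sigma> \<phi>)"
  unfolding shift_fm_def subst_fm_comp by (simp add: lift_subst_def)

lemma subst_inst: "subst_fm \<sigma> (inst_fm E \<phi>) = inst_fm (subst_tm \<sigma> E) (subst_fm (lift_subst \<sigma>) \<phi>)"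
  unfolding inst_fm_def subst_fm_comp
  by (rule subst_fm_cong)
    (auto simp: lift_subst_def subst_tm_comp subst_tm_Var split: nat.split)

text \<open>The quantifier body here is that of \<open>shift_fm (All \<phi>)\<close>. Instantiating
  it with \<open>Var 0\<close>, the eigenvariable of \<open>all_goal\<close>, gives back
  \<open>\<phi>\<close>.\<close>

lemma inst_shift_Var0: "inst_fm (Var 0) (subst_fm (lift_subst (\<lambda>x. Var (Suc x))) \<phi>) = \<phi>"
proof -
  have "inst_fm (Var 0) (subst_fm (lift_subst (\<lambda>x. Var (Suc x))) \<phi>) = subst_fm Var \<phi>"
    unfolding inst_fm_def subst_fm_comp
    by (rule subst_fm_cong) (auto simp: lift_subst_def split: nat.split)
  then show ?thesis by (simp add: subst_fm_Var)
qed

lemma finite_fv_tm: "finite (fv_tm t)"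
  by (induction t) auto

lemma finite_fv_fm: "finite (fv_fm \<phi>)"
proof (induction \<phi>)
  case (All \<phi>)
  then have "finite (Suc -` fv_fm \<phi>)" by (simp add: finite_vimageI)
  then show ?case by (simp add: vimage_def)
qed (auto simp: finite_fv_tm)

section \<open>Well-formedness\<close>

lemma wf_subst_tm: "(\<And>x. wf_tm S (\<sigma> x)) \<Longrightarrow> wf_tm S (subst_tm \<sigma> t) \<longleftrightarrow> wf_tm S t"
  by (induction t) (auto simp: list_all_iff)

lemma wf_lift_subst: "(\<And>x. wf_tm S (\<sigma> x)) \<Longrightarrow> wf_tm S (lift_subst \<sigma> x)"
  by (auto simp: lift_subst_def wf_subst_tm split: nat.split)

lemma wf_subst_fm: "(\<And>x. wf_tm S (\<sigma> x)) \<Longrightarrow> wf_fm S (subst_fm \<sigma> \<phi>) \<longleftrightarrow> wf_fm S \<phi>"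
proof (induction \<phi> arbitrary: \<sigma>)
  case (All \<phi>)
  then show ?case using wf_lift_subst[of S \<sigma>] by simp
qed (auto simp: wf_subst_tm list_all_iff)

lemma wf_shift: "wf_fm S (shift_fm \<phi>) \<longleftrightarrow> wf_fm S \<phi>"
  by (simp add: shift_fm_def wf_subst_fm)

lemma wf_inst: "wf_tm S E \<Longrightarrow> wf_fm S (inst_fm E \<phi>) \<longleftrightarrow> wf_fm S \<phi>"
  unfolding inst_fm_def by (rule wf_subst_fm) (simp split: nat.split)

lemma wf_subst_single: "wf_tm S E \<Longrightarrow> wf_fm S (subst_fm (Var(x := E)) \<phi>) \<longleftrightarrow> wf_fm S \<phi>"
  by (rule wf_subst_fm) simp

lemma provable_wf: "provable S H G \<Longrightarrow> list_all (wf_fm S) H \<and> wf_fm S G"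
  by (induction rule: provable.induct)
    (auto simp: list_all_iff wf_shift wf_inst wf_subst_single)

section \<open>Well-definedness formulas under substitution and renaming\<close>

lemma wf_conjs: "wf_fm S (conjs \<phi>s) \<longleftrightarrow> list_all (wf_fm S) \<phi>s"
  by (induction \<phi>s) (auto simp: conjs_def)

lemma subst_conjs: "subst_fm \<sigma> (conjs \<phi>s) = conjs (map (subst_fm \<sigma>) \<phi>s)"
  by (induction \<phi>s) (auto simp: conjs_def)

context
  fixes S :: "('f, 'p) signature"
  assumes wfS: "wf_signature S"
begin

lemma wf_dom_cond_at:
  assumes "wf_tm S (Fun f ts)" shows "wf_fm S (dom_cond_at S f ts)"
proof -
  have "wf_fm S (dom_cond S f)" using assms wfS by (auto simp: wf_signature_def)
  then show ?thesis
    unfolding dom_cond_at_def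
    by (subst wf_subst_fm) (use assms in \<open>auto simp: list_all_length\<close>)
qed

text \<open>\<open>wf_signature\<close> confines the free variables of a domain condition to the
  argument places, so all of them are filled by \<open>ts\<close> and \<open>\<sigma>\<close> acts
  on the fillings only.\<close>

lemma subst_dom_cond_at:
  assumes "wf_tm S (Fun f ts)"
  shows "subst_fm \<sigma> (dom_cond_at S f ts) = dom_cond_at S f (map (subst_tm \<sigma>) ts)"
proof -
  have "fv_fm (dom_cond S f) \<subseteq> {..<length ts}" using assms wfS by (auto simp: wf_signature_def)
  then show ?thesis
    unfolding dom_cond_at_def subst_fm_comp by (intro subst_fm_cong) auto
qed

lemma wf_wd_tm: "wf_tm S t \<Longrightarrow> wf_fm S (wd_tm S t)"
proof (induction t)
  case (Fun f ts)
  then show ?case using wf_dom_cond_at[of f ts] by (auto simp: wf_conjs list_all_iff)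
qed auto

lemma wf_wd_fm: "wf_fm S \<phi> \<Longrightarrow> wf_fm S (wd_fm S \<phi>)"
  by (induction \<phi>) (auto simp: wf_wd_tm wf_conjs list_all_iff)

text \<open>A renaming sends variables to variables, whose well-definedness is again
  \<open>Truth\<close>. A general substitution can break the identity at variables only;
  \<open>variant\<close> bridges that gap below.\<close>

lemma wd_tm_rename:
  "wf_tm S t \<Longrightarrow> (\<And>x. \<exists>y. \<rho> x = Var y) \<Longrightarrow> wd_tm S (subst_tm \<rho> t) = subst_fm \<rho> (wd_tm S t)"
proof (induction t)
  case (Var x)
  then show ?case by (metis subst_fm.simps(1,5) subst_tm.simps(1) wd_tm.simps(1))
next
  case (Fun f ts)
  then show ?case using subst_dom_cond_at[of f ts \<rho>]
    by (auto simp: subst_conjs list_all_iff intro!: arg_cong[where f = conjs])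
qed

lemma wd_fm_rename:
  "wf_fm S \<phi> \<Longrightarrow> (\<And>x. \<exists>y. \<rho> x = Var y) \<Longrightarrow> wd_fm S (subst_fm \<rho> \<phi>) = subst_fm \<rho> (wd_fm S \<phi>)"
proof (induction \<phi> arbitrary: \<rho>)
  case (Pred p ts)
  then show ?case
    by (auto simp: subst_conjs list_all_iff wd_tm_rename intro!: arg_cong[where f = conjs])
next
  case (Eq s t)
  then show ?case by (simp add: wd_tm_rename)
next
  case (All \<phi>)
  have "\<exists>y. lift_subst \<rho> x = Var y" for x
  proof (cases x)
    case (Suc n)
    obtain y where "\<rho> n = Var y" using All.prems(2) by blast
    then show ?thesis by (simp add: Suc lift_subst_def)
  qed (simp add: lift_subst_def)
  then show ?case using All by simp
qed auto

lemma wd_fm_shift: "wf_fm S \<phi> \<Longrightarrow> wd_fm S (shift_fm \<phi>) = shift_fm (wd_fm S \<phi>)"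
  by (simp add: shift_fm_def wd_fm_rename)

section \<open>Structural rules\<close>

lemma provable_mem: "list_all (wf_fm S) \<Gamma> \<Longrightarrow> P \<in> set \<Gamma> \<Longrightarrow> provable S \<Gamma> P"
  by (induction \<Gamma>) (auto intro: provable.hyp provable.mon)

lemma provable_append: "provable S H G \<Longrightarrow> list_all (wf_fm S) \<Gamma> \<Longrightarrow> provable S (\<Gamma> @ H) G"
  by (induction \<Gamma>) (auto intro: provable.mon)

lemma or_goal1: "provable S \<Gamma> P \<Longrightarrow> wf_fm S Q \<Longrightarrow> provable S \<Gamma> (Or P Q)"
  by (rule provable.neg_goal, rule provable.and_hyp, rule provable.mon, rule provable.neg_hyp) auto

lemma wd_and_goal:
  assumes "provable S \<Gamma> (wd_fm S P)" "provable S \<Gamma> (wd_fm S Q)" "wf_fm S P" "wf_fm S Q"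
  shows "provable S \<Gamma> (wd_fm S (And P Q))"
  using assms by (auto intro!: or_goal1 provable.and_goal simp: wf_wd_fm)

text \<open>Rules act on the head of the list and there is no exchange rule. The hypotheses are
  therefore folded one by one into the accumulator \<open>C\<close> by \<open>and_hyp\<close>;
  conjunction preserves that \<open>C\<close> and its well-definedness are provable from
  \<open>\<Gamma>\<close>.\<close>

lemma refute_by_cuts:
  assumes "provable S (C # H) Falsity" "provable S \<Gamma> C" "provable S \<Gamma> (wd_fm S C)"
    and "\<And>h. h \<in> set H \<Longrightarrow> provable S \<Gamma> h \<and> provable S \<Gamma> (wd_fm S h)"
  shows "provable S \<Gamma> Falsity"
  using assms
proof (induction H arbitrary: C)
  case Nil
  have "provable S \<Gamma> (Neg C)"
    using provable_append[OF provable.neg_goal[OF Nil.prems(1)], of \<Gamma>]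
      provable_wf[OF Nil.prems(2)] by simp
  \<comment> \<open>The cut formula is \<open>Neg C\<close>, whose well-definedness is by definition
    that of \<open>C\<close>.\<close>
  then show ?case
    by (rule provable.cut[rotated]) (use Nil.prems in \<open>auto intro: provable.neg_hyp\<close>)
next
  case (Cons h H)
  have "provable S (And h C # H) Falsity" using Cons.prems(1) by (rule provable.and_hyp)
  moreover have "provable S \<Gamma> (And h C)" using Cons.prems by (auto intro: provable.and_goal)
  moreover have "provable S \<Gamma> (wd_fm S (And h C))"
    by (rule wd_and_goal) (use Cons.prems provable_wf[OF Cons.prems(1)] in auto)
  ultimately show ?case by (rule Cons.IH) (use Cons.prems(4) in simp)
qed

text \<open>
  \<open>cut\<close> needs the well-definedness of the cut formula, and \<open>unfold\<close> supplies it for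
  every hypothesis. Thus \<open>H\<close> and the negated goal can be collected in a single
  conjunction that is cut in afterwards.
\<close>

lemma provable_weaken:
  assumes "provable S H G" "set H \<subseteq> set \<Gamma>" "list_all (wf_fm S) \<Gamma>"
  shows "provable S \<Gamma> G"
proof -
  have wf: "wf_fm S G" using provable_wf[OF assms(1)] by simp
  let ?\<Gamma> = "map (wd_fm S) (Neg G # \<Gamma>) @ wd_fm S Falsity # Neg G # \<Gamma>"
  have mem: "P \<in> set ?\<Gamma> \<Longrightarrow> provable S ?\<Gamma> P" for P
    by (rule provable_mem) (use assms wf in \<open>auto simp: list_all_iff wf_wd_fm\<close>)
  have "provable S (Neg G # H) Falsity" using assms(1) by (rule provable.neg_hyp) simp
  then have "provable S ?\<Gamma> Falsity"
    by (rule refute_by_cuts) (use assms(2) mem in auto)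
  then have "provable S (Neg G # \<Gamma>) Falsity" by (rule provable.unfold)
  then show ?thesis by (rule provable.contr)
qed

text \<open>Contraction, a case of \<open>provable_weaken\<close>, lets the left rules act on any
  member of \<open>\<Gamma>\<close> instead of only on its head.\<close>

lemma provable_absorb: "provable S (P # \<Gamma>) G \<Longrightarrow> P \<in> set \<Gamma> \<Longrightarrow> provable S \<Gamma> G"
  using provable_wf[of S "P # \<Gamma>" G] by (auto intro: provable_weaken)

lemma and_hyp_mem: "provable S (Q # P # \<Gamma>) G \<Longrightarrow> And P Q \<in> set \<Gamma> \<Longrightarrow> provable S \<Gamma> G"
  by (blast intro: provable_absorb provable.and_hyp)

lemma neg_hyp_mem: "provable S \<Gamma> P \<Longrightarrow> Neg P \<in> set \<Gamma> \<Longrightarrow> wf_fm S G \<Longrightarrow> provable S \<Gamma> G"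
  by (blast intro: provable_absorb provable.neg_hyp)

lemma truth_goal: "list_all (wf_fm S) \<Gamma> \<Longrightarrow> provable S \<Gamma> Truth"
  by (rule provable.neg_goal, rule provable.falsity_hyp) auto

lemma conjs_goal:
  "(\<And>\<phi>. \<phi> \<in> set \<phi>s \<Longrightarrow> provable S \<Gamma> \<phi>) \<Longrightarrow> list_all (wf_fm S) \<Gamma> \<Longrightarrow> provable S \<Gamma> (conjs \<phi>s)"
  by (induction \<phi>s) (auto simp: conjs_def truth_goal intro: provable.and_goal)

lemma conjs_hyp:
  assumes "provable S (\<phi>s @ \<Gamma>) G" "conjs \<phi>s \<in> set \<Gamma>" "list_all (wf_fm S) \<Gamma>"
  shows "provable S \<Gamma> G"
  using assms
proof (induction \<phi>s arbitrary: \<Gamma>)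
  case (Cons \<phi> \<phi>s)
  let ?\<Gamma> = "conjs \<phi>s # \<phi> # \<Gamma>"
  have conjs: "conjs (\<phi> # \<phi>s) = And \<phi> (conjs \<phi>s)" by (simp add: conjs_def)
  then have wf: "list_all (wf_fm S) ?\<Gamma>" using Cons.prems by (auto simp: list_all_iff)
  have "provable S ?\<Gamma> G"
  proof (rule Cons.IH)
    have "list_all (wf_fm S) (\<phi>s @ \<Gamma>)" using provable_wf[OF Cons.prems(1)] by simp
    then show "provable S (\<phi>s @ ?\<Gamma>) G"
      using wf by (intro provable_weaken[OF Cons.prems(1)]) auto
  qed (use wf in auto)
  then show ?case using Cons.prems(2) by (auto simp: conjs intro: and_hyp_mem)
qed simp

section \<open>Replacing Truth by hypotheses\<close>

text \<open>
  \<open>subst_fm \<sigma> (wd_tm S t)\<close> and \<open>wd_tm S (subst_tm \<sigma> t)\<close> differ only in that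
  \<open>Truth\<close> in the former is \<open>wd_tm S (\<sigma> x)\<close> in the latter. Such formulas cannot in
  general be exchanged by a plain cut, whose well-definedness premise is not available; but the
  relation \<open>variant\<close> is stable under \<open>wd_fm\<close>, so the premise follows from the
  hypotheses added by \<open>unfold\<close>.
\<close>

inductive variant :: "('f, 'p) fm set \<Rightarrow> ('f, 'p) fm \<Rightarrow> ('f, 'p) fm \<Rightarrow> bool" where
  refl: "variant \<Delta> \<phi> \<phi>"
| hyps: "\<phi> \<in> insert Truth \<Delta> \<Longrightarrow> \<psi> \<in> insert Truth \<Delta> \<Longrightarrow> variant \<Delta> \<phi> \<psi>"
| And: "variant \<Delta> \<phi> \<phi>' \<Longrightarrow> variant \<Delta> \<psi> \<psi>' \<Longrightarrow> variant \<Delta> (And \<phi> \<psi>) (And \<phi>' \<psi>')"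
| Neg: "variant \<Delta> \<phi> \<phi>' \<Longrightarrow> variant \<Delta> (Neg \<phi>) (Neg \<phi>')"
| All: "variant (shift_fm ` \<Delta>) \<phi> \<phi>' \<Longrightarrow> variant \<Delta> (All \<phi>) (All \<phi>')"

lemma variant_mono: "variant \<Delta> \<phi> \<psi> \<Longrightarrow> \<Delta> \<subseteq> \<Delta>' \<Longrightarrow> variant \<Delta>' \<phi> \<psi>"
proof (induction arbitrary: \<Delta>' rule: variant.induct)
  case (hyps \<phi> \<Delta> \<psi>)
  then show ?case by (intro variant.hyps) auto
next
  case (All \<Delta> \<phi> \<phi>')
  then show ?case by (intro variant.All) (simp add: image_mono)
qed (auto intro: variant.intros)

lemma variant_conjs: "list_all2 (variant \<Delta>) \<phi>s \<psi>s \<Longrightarrow> variant \<Delta> (conjs \<phi>s) (conjs \<psi>s)"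
  by (induction rule: list_all2_induct) (auto simp: conjs_def intro: variant.intros)

text \<open>\<open>wd_fm S Truth\<close> is \<open>Truth\<close> again, so related hypotheses stay
  related once their well-definedness formulas join \<open>\<Delta>\<close>. \<open>\<Delta>\<close>
  itself is kept because \<open>wd_fm\<close> of \<open>And\<close> and \<open>All\<close> contains
  the subformulas next to their well-definedness.\<close>

lemma variant_wd:
  assumes "variant \<Delta> \<phi> \<psi>" "\<And>\<delta>. \<delta> \<in> \<Delta> \<Longrightarrow> wf_fm S \<delta>"
  shows "variant (\<Delta> \<union> wd_fm S ` \<Delta>) (wd_fm S \<phi>) (wd_fm S \<psi>)"
  using assms
proof (induction rule: variant.induct)
  case (refl \<Delta> \<phi>)
  show ?case by (rule variant.refl)
next
  case (hyps \<phi> \<Delta> \<psi>)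
  then show ?case by (intro variant.hyps) auto
next
  case (And \<Delta> \<phi> \<phi>' \<psi> \<psi>')
  have "variant (\<Delta> \<union> wd_fm S ` \<Delta>) \<phi> \<phi>'" "variant (\<Delta> \<union> wd_fm S ` \<Delta>) \<psi> \<psi>'"
    by (rule And.hyps[THEN variant_mono]; simp)+
  then show ?case using And.IH And.prems by (auto intro!: variant.And variant.Neg)
next
  case (Neg \<Delta> \<phi> \<phi>')
  then show ?case by simp
next
  case (All \<Delta> \<phi> \<phi>')
  let ?\<Delta> = "\<Delta> \<union> wd_fm S ` \<Delta>"
  \<comment> \<open>Shifting is a renaming and so commutes with \<open>wd_fm\<close> on the
    well-formed members of \<open>\<Delta>\<close>.\<close>
  have eq: "shift_fm ` ?\<Delta> = shift_fm ` \<Delta> \<union> wd_fm S ` shift_fm ` \<Delta>"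
    using All.prems by (force simp: image_Un image_image wd_fm_shift)
  have "variant (shift_fm ` ?\<Delta>) (wd_fm S \<phi>) (wd_fm S \<phi>')"
    unfolding eq by (rule All.IH) (use All.prems in \<open>auto simp: wf_shift\<close>)
  moreover have "variant (shift_fm ` ?\<Delta>) \<phi> \<phi>'"
    using All.hyps by (rule variant_mono) auto
  ultimately show ?case by (auto intro!: variant.And variant.Neg variant.All)
qed

text \<open>Both directions are proved together because \<open>Neg\<close> exchanges them.\<close>

lemma variant_provable:
  assumes "variant \<Delta> \<phi> \<psi>" "\<Delta> \<subseteq> set \<Gamma>" "list_all (wf_fm S) \<Gamma>" "wf_fm S \<phi>" "wf_fm S \<psi>"
  shows "provable S (\<phi> # \<Gamma>) \<psi> \<and> provable S (\<psi> # \<Gamma>) \<phi>"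
  using assms
proof (induction arbitrary: \<Gamma> rule: variant.induct)
  case (refl \<Delta> \<phi>)
  then show ?case by (auto intro: provable.hyp)
next
  case (hyps \<phi> \<Delta> \<psi>)
  then have "provable S \<Gamma> \<psi>" "provable S \<Gamma> \<phi>"
    by (auto intro: provable_mem truth_goal)
  then show ?case using hyps.prems by (auto intro: provable.mon)
next
  case (And \<Delta> \<phi> \<phi>' \<psi> \<psi>')
  have step: "provable S (And \<alpha> \<beta> # \<Gamma>) (And \<alpha>' \<beta>')"
    if "provable S (\<alpha> # \<Gamma>) \<alpha>'" "provable S (\<beta> # \<Gamma>) \<beta>'" for \<alpha> \<beta> \<alpha>' \<beta>'
  proof (rule provable.and_hyp, rule provable.and_goal)
    have wf: "list_all (wf_fm S) (\<beta> # \<alpha> # \<Gamma>)"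
      using provable_wf[OF that(1)] provable_wf[OF that(2)] by simp
    show "provable S (\<beta> # \<alpha> # \<Gamma>) \<alpha>'" "provable S (\<beta> # \<alpha> # \<Gamma>) \<beta>'"
      using provable_weaken[OF that(1) _ wf] provable_weaken[OF that(2) _ wf] by auto
  qed
  show ?case using And.IH And.prems by (auto intro!: step)
next
  case (Neg \<Delta> \<phi> \<phi>')
  have step: "provable S (Neg \<alpha> # \<Gamma>) (Neg \<beta>)" if "provable S (\<beta> # \<Gamma>) \<alpha>" for \<alpha> \<beta>
  proof (rule provable.neg_goal, rule neg_hyp_mem)
    have "list_all (wf_fm S) (\<beta> # Neg \<alpha> # \<Gamma>)" using provable_wf[OF that] by simp
    then show "provable S (\<beta> # Neg \<alpha> # \<Gamma>) \<alpha>" by (intro provable_weaken[OF that]) auto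
  qed auto
  show ?case using Neg.IH Neg.prems by (auto intro!: step)
next
  case (All \<Delta> \<phi> \<phi>')
  have step: "provable S (All \<alpha> # \<Gamma>) (All \<beta>)" if "provable S (\<alpha> # map shift_fm \<Gamma>) \<beta>" for \<alpha> \<beta>
  proof -
    \<comment> \<open>The shifted hypothesis is instantiated with the eigenvariable
      \<open>Var 0\<close>, whose well-definedness is \<open>Truth\<close>; this returns
      \<open>\<alpha>\<close>.\<close>
    have "provable S (map shift_fm (All \<alpha> # \<Gamma>)) \<beta>"
      using that All.prems by (auto simp: shift_fm_def[of "All \<alpha>"] list_all_iff wf_shift
          inst_shift_Var0 intro!: provable.all_hyp[of S _ "Var 0"] truth_goal)
    then show ?thesis by (rule provable.all_goal)
  qed
  have "provable S (\<phi> # map shift_fm \<Gamma>) \<phi>' \<and> provable S (\<phi>' # map shift_fm \<Gamma>) \<phi>"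
    using All.prems by (intro All.IH) (auto simp: list_all_iff wf_shift)
  then show ?case by (auto intro!: step)
qed

text \<open>Supplies the well-definedness premise for cutting in \<open>\<phi>\<close>.
  \<open>\<Gamma>'\<close> stands for a context enlarged by \<open>unfold\<close>, which contains
  the well-definedness of \<open>\<psi>\<close> and of each hypothesis.\<close>

lemma variant_wd_provable:
  assumes "variant \<Delta> \<phi> \<psi>" "\<Delta> \<subseteq> set \<Gamma>" "list_all (wf_fm S) \<Gamma>" "wf_fm S \<phi>" "wf_fm S \<psi>"
    and "set \<Gamma> \<subseteq> set \<Gamma>'" "wd_fm S ` set \<Gamma> \<subseteq> set \<Gamma>'" "wd_fm S \<psi> \<in> set \<Gamma>'"
    and "list_all (wf_fm S) \<Gamma>'"
  shows "provable S \<Gamma>' (wd_fm S \<phi>)"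
proof -
  have "variant (\<Delta> \<union> wd_fm S ` \<Delta>) (wd_fm S \<phi>) (wd_fm S \<psi>)"
    using assms by (intro variant_wd) (auto simp: list_all_iff)
  from variant_provable[OF this, of \<Gamma>'] have "provable S (wd_fm S \<psi> # \<Gamma>') (wd_fm S \<phi>)"
    using assms by (auto simp: wf_wd_fm)
  then show ?thesis using assms by (auto intro: provable_absorb)
qed

text \<open>Unfolding the goal \<open>\<psi>\<close> makes its well-definedness a hypothesis, hence
  that of \<open>\<phi>\<close> provable, and \<open>\<phi>\<close> can be cut in.\<close>

lemma variant_goal:
  assumes "variant \<Delta> \<phi> \<psi>" "\<Delta> \<subseteq> set \<Gamma>" "provable S \<Gamma> \<phi>" "wf_fm S \<psi>"
  shows "provable S \<Gamma> \<psi>"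
proof (rule provable.unfold)
  let ?\<Gamma> = "map (wd_fm S) \<Gamma> @ wd_fm S \<psi> # \<Gamma>"
  have wf: "list_all (wf_fm S) \<Gamma>" "wf_fm S \<phi>" using provable_wf[OF assms(3)] by auto
  then have wf': "list_all (wf_fm S) ?\<Gamma>" using assms by (auto simp: list_all_iff wf_wd_fm)
  show "provable S ?\<Gamma> \<psi>"
  proof (rule provable.cut)
    show "provable S ?\<Gamma> (wd_fm S \<phi>)"
      by (rule variant_wd_provable[OF assms(1,2)]) (use assms wf wf' in auto)
    show "provable S ?\<Gamma> \<phi>" by (rule provable_weaken[OF assms(3) _ wf']) auto
    show "provable S (\<phi> # ?\<Gamma>) \<psi>"
      using variant_provable[OF assms(1) _ wf' wf(2) assms(4)] assms(2) by auto
  qed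
qed

text \<open>As for goals, but the well-definedness of \<open>\<psi>\<close> now comes from unfolding
  it as a hypothesis.\<close>

lemma variant_hyp:
  assumes "variant \<Delta> \<phi> \<psi>" "\<Delta> \<subseteq> set \<Gamma>" "provable S (\<phi> # \<Gamma>) G" "\<psi> \<in> set \<Gamma>"
  shows "provable S \<Gamma> G"
proof (rule provable.unfold)
  let ?\<Gamma> = "map (wd_fm S) \<Gamma> @ wd_fm S G # \<Gamma>"
  have wf: "list_all (wf_fm S) \<Gamma>" "wf_fm S \<phi>" "wf_fm S G"
    using provable_wf[OF assms(3)] by auto
  then have wf\<psi>: "wf_fm S \<psi>" using assms(4) by (auto simp: list_all_iff)
  have wf': "list_all (wf_fm S) ?\<Gamma>" using wf by (auto simp: list_all_iff wf_wd_fm)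
  show "provable S ?\<Gamma> G"
  proof (rule provable.cut)
    show "provable S ?\<Gamma> (wd_fm S \<phi>)"
      by (rule variant_wd_provable[OF assms(1,2)]) (use assms wf wf' wf\<psi> in auto)
    have "provable S (\<psi> # ?\<Gamma>) \<phi>"
      using variant_provable[OF assms(1) _ wf' wf(2) wf\<psi>] assms(2) by auto
    then show "provable S ?\<Gamma> \<phi>" using assms(4) by (auto intro: provable_absorb)
    show "provable S (\<phi> # ?\<Gamma>) G" by (rule provable_weaken[OF assms(3)]) (use wf wf' in auto)
  qed
qed

lemma variant_hyps:
  assumes "\<And>\<phi>. \<phi> \<in> set \<Phi> \<Longrightarrow> \<exists>\<psi> \<in> set \<Gamma>. variant \<Delta> \<phi> \<psi>"
    and "\<Delta> \<subseteq> set \<Gamma>" "provable S (\<Phi> @ \<Gamma>) G"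
  shows "provable S \<Gamma> G"
  using assms
proof (induction \<Phi>)
  case (Cons \<phi> \<Phi>)
  obtain \<psi> where \<psi>: "\<psi> \<in> set \<Gamma>" "variant \<Delta> \<phi> \<psi>" using Cons.prems(1) by auto
  have "provable S (\<Phi> @ \<Gamma>) G"
    by (rule variant_hyp[OF \<psi>(2)]) (use \<psi>(1) Cons.prems in auto)
  then show ?case using Cons by auto
qed simp

section \<open>Closure of provability under substitution\<close>

text \<open>Domain conditions commute with \<open>\<sigma>\<close> exactly, so the two formulas
  differ only at variables.\<close>

lemma variant_subst_wd_tm:
  "wf_tm S t \<Longrightarrow> (\<And>x. wd_tm S (\<sigma> x) \<in> insert Truth \<Delta>) \<Longrightarrow>
    variant \<Delta> (subst_fm \<sigma> (wd_tm S t)) (wd_tm S (subst_tm \<sigma> t))"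
proof (induction t)
  case (Var x)
  then show ?case by (auto intro: variant.hyps)
next
  case (Fun f ts)
  have "list_all2 (variant \<Delta>) (map (subst_fm \<sigma>) (map (wd_tm S) ts))
      (map (wd_tm S) (map (subst_tm \<sigma>) ts))"
    using Fun by (auto simp: list_all2_conv_all_nth list_all_length)
  from variant_conjs[OF this] show ?case
    using subst_dom_cond_at[OF Fun.prems(1)]
    by (auto simp: subst_conjs intro!: variant.And variant.refl)
qed

lemma variant_subst_wd_fm:
  assumes "wf_fm S \<phi>" "\<And>x. wf_tm S (\<sigma> x)" "\<And>x. wd_tm S (\<sigma> x) \<in> insert Truth \<Delta>"
  shows "variant \<Delta> (subst_fm \<sigma> (wd_fm S \<phi>)) (wd_fm S (subst_fm \<sigma> \<phi>))"
  using assms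
proof (induction \<phi> arbitrary: \<sigma> \<Delta>)
  case (Pred p ts)
  have "list_all2 (variant \<Delta>) (map (subst_fm \<sigma>) (map (wd_tm S) ts))
      (map (wd_tm S) (map (subst_tm \<sigma>) ts))"
    using Pred by (auto simp: list_all2_conv_all_nth list_all_length intro!: variant_subst_wd_tm)
  from variant_conjs[OF this] show ?case by (simp add: subst_conjs)
next
  case (All \<phi>)
  \<comment> \<open>Index 0 stays a variable and contributes \<open>Truth\<close>; the other values
    are shifted, and shifting commutes with \<open>wd_tm\<close>.\<close>
  have "wd_tm S (lift_subst \<sigma> x) \<in> insert Truth (shift_fm ` \<Delta>)" for x
  proof (cases x)
    case (Suc n)
    have "wd_tm S (lift_subst \<sigma> x) = shift_fm (wd_tm S (\<sigma> n))"
      using All.prems(2) by (simp add: Suc lift_subst_def shift_fm_def wd_tm_rename)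
    then show ?thesis using All.prems(3)[of n] by (auto simp: shift_fm_def)
  qed (simp add: lift_subst_def)
  then have "variant (shift_fm ` \<Delta>) (subst_fm (lift_subst \<sigma>) (wd_fm S \<phi>))
      (wd_fm S (subst_fm (lift_subst \<sigma>) \<phi>))"
    using All.prems by (intro All.IH) (auto intro: wf_lift_subst)
  then show ?case by (auto intro!: variant.intros)
qed (auto intro!: variant.And variant.Neg variant.refl variant_subst_wd_tm)

text \<open>Induction on the derivation, with \<open>\<Gamma>\<close> any context containing the
  substituted hypotheses, so that the formulas \<open>wd_tm S (\<sigma> x)\<close> can be carried
  along. \<open>cut\<close>, \<open>all_hyp\<close> and \<open>unfold\<close> mention
  well-definedness, and there the \<open>variant\<close> lemmas exchange substituting before and
  after taking it.\<close>

lemma provable_subst: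
  assumes "provable S H G"
    and "\<And>x. wf_tm S (\<sigma> x)" "\<And>x. wd_tm S (\<sigma> x) \<in> insert Truth (set \<Gamma>)"
    and "list_all (wf_fm S) \<Gamma>" "subst_fm \<sigma> ` set H \<subseteq> set \<Gamma>"
  shows "provable S \<Gamma> (subst_fm \<sigma> G)"
  using assms
proof (induction arbitrary: \<sigma> \<Gamma> rule: provable.induct)
  case (hyp H P)
  then show ?case by (auto intro: provable_mem)
next
  case (mon H Q P)
  then show ?case by auto
next
  case (contr Q H)
  have "provable S (Neg (subst_fm \<sigma> Q) # \<Gamma>) (subst_fm \<sigma> Falsity)"
    using contr.prems provable_wf[OF contr.hyps]
    by (intro contr.IH) (auto simp: wf_subst_fm)
  then show ?case by (auto intro: provable.contr)
next
  case (falsity_hyp H P)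
  have "provable S (Falsity # \<Gamma>) (subst_fm \<sigma> P)"
    using falsity_hyp by (auto intro: provable.falsity_hyp simp: wf_subst_fm)
  then show ?case by (rule provable_absorb) (use falsity_hyp.prems in auto)
next
  case (neg_goal P H)
  have "provable S (subst_fm \<sigma> P # \<Gamma>) (subst_fm \<sigma> Falsity)"
    using neg_goal.prems provable_wf[OF neg_goal.hyps]
    by (intro neg_goal.IH) (auto simp: wf_subst_fm)
  then show ?case by (auto intro: provable.neg_goal)
next
  case (neg_hyp H P Q)
  have "provable S \<Gamma> (subst_fm \<sigma> P)" using neg_hyp.prems by (intro neg_hyp.IH) auto
  then show ?case
    by (rule neg_hyp_mem) (use neg_hyp in \<open>auto simp: wf_subst_fm\<close>)
next
  case (and_goal H P Q)
  then show ?case by (auto intro: provable.and_goal)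
next
  case (and_hyp Q P H R)
  have "provable S (subst_fm \<sigma> Q # subst_fm \<sigma> P # \<Gamma>) (subst_fm \<sigma> R)"
    using and_hyp.prems provable_wf[OF and_hyp.hyps]
    by (intro and_hyp.IH) (auto simp: wf_subst_fm)
  then show ?case by (rule and_hyp_mem) (use and_hyp.prems in auto)
next
  case (all_goal H P)
  have "provable S (map shift_fm \<Gamma>) (subst_fm (lift_subst \<sigma>) P)"
  proof (rule all_goal.IH)
    show "wf_tm S (lift_subst \<sigma> x)" for x using all_goal.prems(1) by (rule wf_lift_subst)
    show "wd_tm S (lift_subst \<sigma> x) \<in> insert Truth (set (map shift_fm \<Gamma>))" for x
    proof (cases x)
      case (Suc n)
      have "wd_tm S (lift_subst \<sigma> x) = shift_fm (wd_tm S (\<sigma> n))"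
        using all_goal.prems(1) by (simp add: Suc lift_subst_def shift_fm_def wd_tm_rename)
      then show ?thesis using all_goal.prems(2)[of n] by (auto simp: shift_fm_def)
    qed (simp add: lift_subst_def)
    show "list_all (wf_fm S) (map shift_fm \<Gamma>)"
      using all_goal.prems(3) by (simp add: list_all_iff wf_shift)
    show "subst_fm (lift_subst \<sigma>) ` set (map shift_fm H) \<subseteq> set (map shift_fm \<Gamma>)"
      using all_goal.prems(4) by (auto simp: shift_subst)
  qed
  then show ?case by (auto intro: provable.all_goal)
next
  case (eq_goal H E)
  then show ?case by (auto intro: provable.eq_goal simp: wf_subst_tm)
next
  case (eq_hyp H x E P F)
  \<comment> \<open>The variable \<open>x\<close> may also occur in values of
    \<open>\<sigma>\<close>, so it cannot mark the replaced places after substitution. A fresh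
    \<open>z\<close> takes over this role.\<close>
  obtain z where z: "z \<notin> (\<Union>y \<in> fv_fm P. fv_tm (\<sigma> y))"
    using ex_new_if_finite[of "\<Union>y \<in> fv_fm P. fv_tm (\<sigma> y)"] finite_fv_fm finite_fv_tm
    by (metis finite_UN_I infinite_UNIV_nat)
  let ?P = "subst_fm (\<sigma>(x := Var z)) P"
  have swap: "subst_fm (Var(z := subst_tm \<sigma> T)) ?P = subst_fm \<sigma> (subst_fm (Var(x := T)) P)" for T
    unfolding subst_fm_comp using z by (intro subst_fm_cong) (auto simp: subst_tm_fresh)
  have "provable S \<Gamma> (subst_fm \<sigma> (subst_fm (Var(x := E)) P))"
    using eq_hyp.prems by (intro eq_hyp.IH) auto
  then have "provable S (Eq (subst_tm \<sigma> E) (subst_tm \<sigma> F) # \<Gamma>)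
      (subst_fm (Var(z := subst_tm \<sigma> F)) ?P)"
    using eq_hyp.hyps eq_hyp.prems by (intro provable.eq_hyp) (auto simp: swap wf_subst_tm)
  then show ?case unfolding swap by (rule provable_absorb) (use eq_hyp.prems in auto)
next
  case (cut H P Q)
  have wf: "wf_fm S P" "wf_fm S (subst_fm \<sigma> P)"
    using provable_wf[OF cut.hyps(2)] cut.prems by (auto simp: wf_subst_fm)
  have "provable S \<Gamma> (subst_fm \<sigma> (wd_fm S P))" using cut.prems by (intro cut.IH) auto
  \<comment> \<open>The induction hypothesis gives the substituted well-definedness of
    \<open>P\<close>; the rule needs the well-definedness of the substituted
    \<open>P\<close>.\<close>
  then have "provable S \<Gamma> (wd_fm S (subst_fm \<sigma> P))"
    by (rule variant_goal[of "set \<Gamma>", OF variant_subst_wd_fm, rotated 4])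
      (use wf cut.prems in \<open>auto simp: wf_wd_fm\<close>)
  moreover have "provable S \<Gamma> (subst_fm \<sigma> P)" using cut.prems by (intro cut.IH) auto
  moreover have "provable S (subst_fm \<sigma> P # \<Gamma>) (subst_fm \<sigma> Q)"
    using cut.prems wf by (intro cut.IH) auto
  ultimately show ?case by (rule provable.cut)
next
  case (all_hyp H E P Q)
  have wf: "wf_fm S P" "wf_tm S (subst_tm \<sigma> E)"
    using provable_wf[OF all_hyp.hyps(2)] all_hyp by (auto simp: wf_inst wf_subst_tm)
  have "provable S \<Gamma> (subst_fm \<sigma> (wd_tm S E))" using all_hyp.prems by (intro all_hyp.IH) auto
  then have "provable S \<Gamma> (wd_tm S (subst_tm \<sigma> E))"
    by (rule variant_goal[of "set \<Gamma>", OF variant_subst_wd_tm, rotated 3])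
      (use wf all_hyp.hyps all_hyp.prems in \<open>auto simp: wf_wd_tm\<close>)
  moreover have "provable S (subst_fm \<sigma> (inst_fm E P) # \<Gamma>) (subst_fm \<sigma> Q)"
    using all_hyp.prems all_hyp.hyps wf by (intro all_hyp.IH) (auto simp: wf_subst_fm wf_inst)
  ultimately have "provable S (All (subst_fm (lift_subst \<sigma>) P) # \<Gamma>) (subst_fm \<sigma> Q)"
    using wf by (auto simp: subst_inst intro: provable.all_hyp)
  then show ?case by (rule provable_absorb) (use all_hyp.prems in auto)
next
  case (unfold H G)
  let ?D = "map (wd_fm S) \<Gamma> @ wd_fm S (subst_fm \<sigma> G) # \<Gamma>"
  let ?\<Phi> = "map (subst_fm \<sigma>) (map (wd_fm S) (G # H))"
  have wf: "list_all (wf_fm S) H" "wf_fm S G" using provable_wf[OF unfold.hyps] by auto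
  \<comment> \<open>The substituted well-definedness formulas \<open>?\<Phi>\<close> are first added
    as hypotheses, then discharged because each has a variant in \<open>?D\<close>.\<close>
  have "provable S (?\<Phi> @ ?D) (subst_fm \<sigma> G)"
    using unfold.prems wf
    by (intro unfold.IH) (auto simp: list_all_iff wf_subst_fm wf_wd_fm)
  then have "provable S ?D (subst_fm \<sigma> G)"
  proof (rule variant_hyps[rotated 2])
    fix \<phi> assume "\<phi> \<in> set ?\<Phi>"
    then obtain h where h: "h \<in> set (G # H)" "\<phi> = subst_fm \<sigma> (wd_fm S h)" by auto
    then have "wf_fm S h" using wf by (auto simp: list_all_iff)
    then have "variant (set \<Gamma>) \<phi> (wd_fm S (subst_fm \<sigma> h))"
      unfolding h(2) using unfold.prems by (intro variant_subst_wd_fm) auto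
    moreover have "wd_fm S (subst_fm \<sigma> h) \<in> set ?D" using h unfold.prems by auto
    ultimately show "\<exists>\<psi> \<in> set ?D. variant (set \<Gamma>) \<phi> \<psi>" by blast
  qed auto
  then show ?case by (rule provable.unfold)
qed

section \<open>Rewriting at a position\<close>

lemma wf_replace_at:
  "wf_tm S t \<Longrightarrow> p \<in> positions t \<Longrightarrow> wf_tm S s \<Longrightarrow> wf_tm S (replace_at t p s)"
proof (induction t p s rule: replace_at.induct)
  case (2 f ts i p s)
  then show ?case by (auto simp: list_all_length nth_list_update)
qed auto

text \<open>With \<open>Var z\<close> for \<open>u\<close>, the term becomes a context whose hole is
  marked by \<open>z\<close>, so that \<open>eq_hyp\<close> can rewrite at the position.\<close>

lemma subst_replace_at:
  "z \<notin> fv_tm t \<Longrightarrow> p \<in> positions t \<Longrightarrow>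
    subst_tm (Var(z := s)) (replace_at t p u) = replace_at t p (subst_tm (Var(z := s)) u)"
proof (induction t p u rule: replace_at.induct)
  case (2 f ts i p u)
  have i: "i < length ts" "p \<in> positions (ts ! i)" "z \<notin> fv_tm (ts ! i)" using 2 by auto
  have "map (subst_tm (Var(z := s))) ts = ts"
    using 2 by (auto intro!: map_idI subst_tm_fresh)
  then show ?case using 2 i by (simp add: map_update fun_upd_def)
qed auto

section \<open>Extracting the conjuncts of a well-definedness hypothesis\<close>

lemma wd_fun_hyp:
  assumes "provable S (dom_cond_at S f ts # map (wd_tm S) ts @ \<Gamma>) G"
    and "wd_tm S (Fun f ts) \<in> set \<Gamma>"
  shows "provable S \<Gamma> G"
proof (rule and_hyp_mem)
  let ?\<Gamma> = "dom_cond_at S f ts # conjs (map (wd_tm S) ts) # \<Gamma>"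
  show "And (conjs (map (wd_tm S) ts)) (dom_cond_at S f ts) \<in> set \<Gamma>" using assms(2) by simp
  have wf: "list_all (wf_fm S) (dom_cond_at S f ts # map (wd_tm S) ts @ \<Gamma>)"
    using provable_wf[OF assms(1)] by simp
  show "provable S ?\<Gamma> G"
  proof (rule conjs_hyp)
    show "provable S (map (wd_tm S) ts @ ?\<Gamma>) G"
      by (rule provable_weaken[OF assms(1)]) (use wf in \<open>auto simp: wf_conjs\<close>)
  qed (use wf in \<open>auto simp: wf_conjs\<close>)
qed

lemma wd_arg_hyp:
  assumes "provable S (wd_tm S s # \<Gamma>) G" "wd_tm S (Fun f ts) \<in> set \<Gamma>" "s \<in> set ts"
    and "wf_tm S (Fun f ts)"
  shows "provable S \<Gamma> G"
proof (rule wd_fun_hyp[OF _ assms(2)])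
  show "provable S (dom_cond_at S f ts # map (wd_tm S) ts @ \<Gamma>) G"
    using provable_wf[OF assms(1)] assms(3,4) wf_dom_cond_at[OF assms(4)]
    by (intro provable_weaken[OF assms(1)]) (auto simp: list_all_iff wf_wd_tm)
qed

text \<open>Descending in \<open>t\<close> to an occurrence of \<open>x\<close>, the
  well-definedness of each argument is a conjunct of that of the application; the descent ends at
  \<open>\<sigma> x\<close>.\<close>

lemma wd_subst_var_hyp:
  assumes "provable S (wd_tm S (\<sigma> x) # \<Gamma>) G" "wd_tm S (subst_tm \<sigma> t) \<in> set \<Gamma>" "x \<in> fv_tm t"
    and "wf_tm S (subst_tm \<sigma> t)"
  shows "provable S \<Gamma> G"
  using assms
proof (induction t arbitrary: \<Gamma>)
  case (Var y)
  then show ?case by (auto intro: provable_absorb)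
next
  case (Fun f ts)
  obtain s where s: "s \<in> set ts" "x \<in> fv_tm s" using Fun.prems by auto
  then have wf: "wf_tm S (subst_tm \<sigma> s)" using Fun.prems by (auto simp: list_all_iff)
  have "list_all (wf_fm S) (wd_tm S (\<sigma> x) # wd_tm S (subst_tm \<sigma> s) # \<Gamma>)"
    using provable_wf[OF Fun.prems(1)] wf by (auto simp: wf_wd_tm)
  then have "provable S (wd_tm S (\<sigma> x) # wd_tm S (subst_tm \<sigma> s) # \<Gamma>) G"
    by (intro provable_weaken[OF Fun.prems(1)]) auto
  then have "provable S (wd_tm S (subst_tm \<sigma> s) # \<Gamma>) G"
    by (rule Fun.IH[OF s(1)]) (use s wf in auto)
  then show ?case
    using s Fun.prems by (auto intro!: wd_arg_hyp[of "subst_tm \<sigma> s" \<Gamma> G f "map (subst_tm \<sigma>) ts"])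
qed

lemma wd_subst_vars_hyp:
  assumes "provable S (map (\<lambda>x. wd_tm S (\<sigma> x)) xs @ \<Gamma>) G" "wd_tm S (subst_tm \<sigma> t) \<in> set \<Gamma>"
    and "set xs \<subseteq> fv_tm t" "wf_tm S (subst_tm \<sigma> t)"
  shows "provable S \<Gamma> G"
  using assms
proof (induction xs)
  case (Cons x xs)
  have "provable S (map (\<lambda>x. wd_tm S (\<sigma> x)) xs @ \<Gamma>) G"
    by (rule wd_subst_var_hyp[of \<sigma> x _ G t]) (use Cons.prems in auto)
  then show ?case using Cons by auto
qed simp

text \<open>Provides the context required by \<open>provable_subst\<close>. Inside the finite set
  \<open>Dom \<sigma>\<close> the formulas are extracted from the hypothesis on \<open>t\<close>;
  outside it \<open>\<sigma> x\<close> is \<open>Var x\<close> and the formula is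
  \<open>Truth\<close>.\<close>

lemma wd_subst_hyps:
  assumes "substitution S \<sigma>" "Dom \<sigma> \<subseteq> fv_tm t" "wf_tm S t"
    and "wd_tm S (subst_tm \<sigma> t) \<in> set \<Gamma>" "list_all (wf_fm S) \<Gamma>"
    and "\<And>\<Gamma>'. \<lbrakk>set \<Gamma> \<subseteq> set \<Gamma>'; list_all (wf_fm S) \<Gamma>';
      \<And>x. wd_tm S (\<sigma> x) \<in> insert Truth (set \<Gamma>')\<rbrakk> \<Longrightarrow> provable S \<Gamma>' G"
  shows "provable S \<Gamma> G"
proof (rule wd_subst_vars_hyp[OF _ assms(4)])
  let ?xs = "sorted_list_of_set (Dom \<sigma>)"
  have \<sigma>: "finite (Dom \<sigma>)" "wf_tm S (\<sigma> x)" for x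
    using assms(1) by (auto simp: substitution_def)
  show "set ?xs \<subseteq> fv_tm t" using \<sigma>(1) assms(2) by simp
  show "wf_tm S (subst_tm \<sigma> t)" using \<sigma>(2) assms(3) by (simp add: wf_subst_tm)
  let ?\<Gamma> = "map (\<lambda>x. wd_tm S (\<sigma> x)) ?xs @ \<Gamma>"
  have "wd_tm S (\<sigma> x) \<in> insert Truth (set ?\<Gamma>)" for x
    using \<sigma>(1) by (cases "x \<in> Dom \<sigma>") (auto simp: Dom_def)
  moreover have "list_all (wf_fm S) ?\<Gamma>"
    using assms(5) \<sigma>(2) by (auto simp: list_all_iff wf_wd_tm)
  ultimately show "provable S ?\<Gamma> G" by (intro assms(6)) auto
qed

lemma wd_replace_at_hyp:
  assumes "provable S (wd_tm S s # \<Gamma>) G" "wd_tm S (replace_at t p s) \<in> set \<Gamma>"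
    and "p \<in> positions t" "wf_tm S t" "wf_tm S s"
  shows "provable S \<Gamma> G"
  using assms
proof (induction t p s arbitrary: \<Gamma> rule: replace_at.induct)
  case (1 t s)
  then show ?case by (auto intro: provable_absorb)
next
  case (2 f ts i p s)
  have i: "i < length ts" "p \<in> positions (ts ! i)" using 2 by auto
  let ?u = "replace_at (ts ! i) p s"
  have wf: "wf_tm S (ts ! i)" "wf_tm S ?u" "wf_tm S (Fun f (ts[i := ?u]))"
    using 2(5,6) i wf_replace_at[of "ts ! i" p s] wf_replace_at[of "Fun f ts" "i # p" s]
      2(4) by (auto simp: list_all_length)
  have "list_all (wf_fm S) (wd_tm S s # wd_tm S ?u # \<Gamma>)"
    using provable_wf[OF 2(2)] wf by (auto simp: wf_wd_tm)
  then have "provable S (wd_tm S s # wd_tm S ?u # \<Gamma>) G"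
    by (intro provable_weaken[OF 2(2)]) auto
  then have "provable S (wd_tm S ?u # \<Gamma>) G"
    by (rule 2(1)) (use i wf 2(6) in auto)
  then show ?case
    by (rule wd_arg_hyp[of _ _ _ f "ts[i := ?u]"])
      (use 2(3) i wf in \<open>auto simp: set_update_memI\<close>)
qed auto

section \<open>Rewriting with a provable equation\<close>

lemma eq_rewrite_goal:
  assumes eq: "provable S \<Gamma> (Eq a b)"
    and "provable S \<Gamma> (wd_tm S a)" "provable S \<Gamma> (wd_tm S b)"
    and P: "provable S \<Gamma> (subst_fm (Var(z := a)) P)"
  shows "provable S \<Gamma> (subst_fm (Var(z := b)) P)"
\<comment> \<open>\<open>eq_hyp\<close> wants the equation as a hypothesis, so it is cut in; its
  well-definedness is the conjunction of those of \<open>a\<close> and \<open>b\<close>.\<close>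
proof (rule provable.cut[OF _ eq])
  show "provable S \<Gamma> (wd_fm S (Eq a b))" using assms by (auto intro: provable.and_goal)
  show "provable S (Eq a b # \<Gamma>) (subst_fm (Var(z := b)) P)"
    using P provable_wf[OF eq] by (auto intro: provable.eq_hyp)
qed

text \<open>The reflexive equation of \<open>?u\<close> is read as \<open>?P\<close> with
  \<open>a\<close> for \<open>z\<close>; only its right-hand side contains \<open>z\<close>, so
  rewriting \<open>a\<close> to \<open>b\<close> leaves the left-hand side alone.\<close>

lemma eq_replace_at:
  assumes "wf_tm S t" "p \<in> positions t"
    and eq: "provable S \<Gamma> (Eq a b)"
    and "provable S \<Gamma> (wd_tm S a)" "provable S \<Gamma> (wd_tm S b)"
  shows "provable S \<Gamma> (Eq (replace_at t p a) (replace_at t p b))"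
proof -
  let ?u = "replace_at t p a"
  obtain z where z: "z \<notin> fv_tm t" "z \<notin> fv_tm ?u"
    using ex_new_if_finite[of "fv_tm t \<union> fv_tm ?u"] finite_fv_tm by auto
  let ?P = "Eq ?u (replace_at t p (Var z)) :: ('f, 'p) fm"
  have P: "subst_fm (Var(z := s)) ?P = Eq ?u (replace_at t p s)" for s
    using z assms(2) by (simp add: subst_tm_fresh subst_replace_at)
  have "provable S \<Gamma> (Eq ?u ?u)"
    using provable_wf[OF eq] assms(1,2) by (auto intro!: provable.eq_goal wf_replace_at)
  then show ?thesis using eq_rewrite_goal[of \<Gamma> a b z ?P] assms unfolding P by blast
qed

text \<open>Putting a fresh variable at argument \<open>i\<close> turns the domain condition into a
  formula in which \<open>a\<close> can be rewritten to \<open>b\<close>.\<close>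

lemma dom_cond_at_update:
  assumes "wf_tm S (Fun f ts)" "i < length ts"
    and "provable S \<Gamma> (Eq a b)" "provable S \<Gamma> (wd_tm S a)" "provable S \<Gamma> (wd_tm S b)"
    and "provable S \<Gamma> (dom_cond_at S f (ts[i := a]))"
  shows "provable S \<Gamma> (dom_cond_at S f (ts[i := b]))"
proof -
  obtain z where z: "z \<notin> fv_tm (Fun f ts)"
    using ex_new_if_finite[of "fv_tm (Fun f ts)"] finite_fv_tm by auto
  have wf: "wf_tm S (Fun f (ts[i := Var z]))"
    using assms(1,2) by (auto simp: list_all_length nth_list_update)
  have "map (subst_tm (Var(z := s))) ts = ts" for s
    using z by (auto intro!: map_idI subst_tm_fresh)
  then have P: "subst_fm (Var(z := s)) (dom_cond_at S f (ts[i := Var z]))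
      = dom_cond_at S f (ts[i := s])" for s
    using subst_dom_cond_at[OF wf] by (simp add: map_update)
  show ?thesis
    using eq_rewrite_goal[of \<Gamma> a b z "dom_cond_at S f (ts[i := Var z])"] assms
    unfolding P by blast
qed

text \<open>Along the path to \<open>p\<close>, each application changes in one argument: its
  conjunct is handled by induction, its domain condition by rewriting. \<open>eq\<close> and
  \<open>wd\<close> range over all contexts because the context grows on the way down.\<close>

lemma wd_replace_at:
  assumes wf: "wf_tm S a" "wf_tm S b"
    and eq: "\<And>\<Gamma>. list_all (wf_fm S) \<Gamma> \<Longrightarrow> c \<in> set \<Gamma> \<Longrightarrow> provable S \<Gamma> (Eq a b)"
    and wd: "\<And>\<Gamma>. list_all (wf_fm S) \<Gamma> \<Longrightarrow> c \<in> set \<Gamma> \<Longrightarrow> wd_tm S a \<in> set \<Gamma> \<Longrightarrow>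
      provable S \<Gamma> (wd_tm S b)"
    and "wf_tm S t" "p \<in> positions t"
    and "list_all (wf_fm S) \<Gamma>" "c \<in> set \<Gamma>" "wd_tm S (replace_at t p a) \<in> set \<Gamma>"
  shows "provable S \<Gamma> (wd_tm S (replace_at t p b))"
  using assms(5-)
proof (induction p arbitrary: t \<Gamma>)
  case Nil
  then show ?case by (auto intro: wd)
next
  case (Cons i p)
  obtain f ts where t: "t = Fun f ts" using Cons.prems(2) by (cases t) auto
  have i: "i < length ts" "p \<in> positions (ts ! i)" "wf_tm S (ts ! i)"
    using Cons.prems(1,2) by (auto simp: t list_all_length)
  let ?u = "replace_at (ts ! i) p a" and ?v = "replace_at (ts ! i) p b"
  \<comment> \<open>The hypothesis on the whole term, split into its conjuncts;
    \<open>wd_fun_hyp\<close> justifies this at the end.\<close>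
  let ?\<Gamma> = "dom_cond_at S f (ts[i := ?u]) # map (wd_tm S) (ts[i := ?u]) @ \<Gamma>"
  have wf_u: "wf_tm S ?u" "wf_tm S (Fun f (ts[i := ?u]))"
    using wf_replace_at[OF i(3,2) wf(1)] wf_replace_at[OF Cons.prems(1,2) wf(1)] by (auto simp: t)
  then have wf_\<Gamma>: "list_all (wf_fm S) ?\<Gamma>"
    using wf_dom_cond_at Cons.prems(3) by (auto simp: list_all_iff wf_wd_tm)
  have u: "wd_tm S ?u \<in> set ?\<Gamma>" using i(1) by (auto simp: set_update_memI)
  have v: "provable S ?\<Gamma> (wd_tm S ?v)"
    by (rule Cons.IH[OF i(3,2) wf_\<Gamma> _ u]) (use Cons.prems(4) in simp)
  \<comment> \<open>Since \<open>?u\<close> contains \<open>a\<close> at \<open>p\<close>, its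
    well-definedness yields that of \<open>a\<close>, and \<open>wd\<close> then yields that of
    \<open>b\<close>.\<close>
  have "provable S ?\<Gamma> (wd_tm S a)" "provable S ?\<Gamma> (wd_tm S b)"
    by (rule wd_replace_at_hyp[OF _ u i(2,3) wf(1)];
        use wf_\<Gamma> wf(1) Cons.prems(4) in \<open>auto intro!: provable.hyp wd simp: wf_wd_tm\<close>)+
  then have uv: "provable S ?\<Gamma> (Eq ?u ?v)"
    by (rule eq_replace_at[OF i(3,2) eq, rotated 2]) (use wf_\<Gamma> Cons.prems(4) in auto)
  have goal: "provable S ?\<Gamma> (wd_tm S (Fun f (ts[i := ?v])))"
    unfolding wd_tm.simps
  proof (rule provable.and_goal)
    show "provable S ?\<Gamma> (conjs (map (wd_tm S) (ts[i := ?v])))"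
    proof (rule conjs_goal[OF _ wf_\<Gamma>])
      fix \<phi> assume "\<phi> \<in> set (map (wd_tm S) (ts[i := ?v]))"
      then obtain j where j: "j < length ts" "\<phi> = wd_tm S (ts[i := ?v] ! j)"
        by (auto simp: in_set_conv_nth)
      show "provable S ?\<Gamma> \<phi>"
      proof (cases "j = i")
        case True
        then show ?thesis using v j by simp
      next
        case False
        then have "\<phi> = wd_tm S (ts[i := ?u] ! j)" using j by simp
        then have "\<phi> \<in> set (map (wd_tm S) (ts[i := ?u]))"
          using nth_mem[of j "ts[i := ?u]"] j(1) by simp
        then show ?thesis by (intro provable_mem[OF wf_\<Gamma>]) simp
      qed
    qed
    \<comment> \<open>The domain condition for \<open>?u\<close> is a hypothesis and is rewritten
      with \<open>uv\<close>, both sides of which are provably well-defined.\<close>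
    show "provable S ?\<Gamma> (dom_cond_at S f (ts[i := ?v]))"
      by (rule dom_cond_at_update[OF _ i(1) uv provable_mem[OF wf_\<Gamma> u] v])
        (use Cons.prems(1) t in \<open>auto intro: provable_mem[OF wf_\<Gamma>]\<close>)
  qed
  show ?case by (rule wd_fun_hyp) (use goal Cons.prems(5) t in simp_all)
qed

section \<open>Instances of the rewrite rule\<close>

lemma rewrite_eq:
  assumes "substitution S \<sigma>" "Dom \<sigma> \<subseteq> fv_tm l" "provable S [c] (Eq l r)"
    and "list_all (wf_fm S) \<Gamma>" "subst_fm \<sigma> c \<in> set \<Gamma>"
  shows "provable S \<Gamma> (Eq (subst_tm \<sigma> l) (subst_tm \<sigma> r))"
proof (rule provable.unfold, rule and_hyp_mem)
  let ?l = "subst_tm \<sigma> l" and ?r = "subst_tm \<sigma> r"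
  let ?\<Gamma> = "map (wd_fm S) \<Gamma> @ wd_fm S (Eq ?l ?r) # \<Gamma>"
  have \<sigma>: "wf_tm S (\<sigma> x)" for x using assms(1) by (auto simp: substitution_def)
  have wf: "wf_tm S l" "wf_tm S r" using provable_wf[OF assms(3)] by auto
  \<comment> \<open>Unfolding the goal equation provides the well-definedness of \<open>?l\<close>,
    from which that of every \<open>\<sigma> x\<close> follows.\<close>
  show "And (wd_tm S ?l) (wd_tm S ?r) \<in> set ?\<Gamma>" by simp
  show "provable S (wd_tm S ?r # wd_tm S ?l # ?\<Gamma>) (Eq ?l ?r)"
  proof (rule wd_subst_hyps[OF assms(1,2) wf(1)])
    show "list_all (wf_fm S) (wd_tm S ?r # wd_tm S ?l # ?\<Gamma>)"
      using assms(4) wf \<sigma> by (auto simp: list_all_iff wf_wd_fm wf_wd_tm wf_subst_tm)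
    fix \<Gamma>' assume "set (wd_tm S ?r # wd_tm S ?l # ?\<Gamma>) \<subseteq> set \<Gamma>'" "list_all (wf_fm S) \<Gamma>'"
      "\<And>x. wd_tm S (\<sigma> x) \<in> insert Truth (set \<Gamma>')"
    then have "provable S \<Gamma>' (subst_fm \<sigma> (Eq l r))"
      by (intro provable_subst[OF assms(3) \<sigma>]) (use assms(5) in auto)
    then show "provable S \<Gamma>' (Eq ?l ?r)" by simp
  qed simp
qed

text \<open>Substituting into the WD-preservation sequent gives the substituted well-definedness of
  \<open>l\<close> and \<open>r\<close>; both are exchanged for variants, once as a hypothesis and
  once as the goal.\<close>

lemma rewrite_wd:
  assumes "substitution S \<sigma>" "Dom \<sigma> \<subseteq> fv_tm l" "wf_tm S l" "wf_tm S r"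
    and "provable S [c, wd_tm S l] (wd_tm S r)"
    and "list_all (wf_fm S) \<Gamma>" "subst_fm \<sigma> c \<in> set \<Gamma>" "wd_tm S (subst_tm \<sigma> l) \<in> set \<Gamma>"
  shows "provable S \<Gamma> (wd_tm S (subst_tm \<sigma> r))"
proof (rule wd_subst_hyps[OF assms(1-3,8,6)])
  have \<sigma>: "wf_tm S (\<sigma> x)" for x using assms(1) by (auto simp: substitution_def)
  fix \<Gamma>' assume \<Gamma>': "set \<Gamma> \<subseteq> set \<Gamma>'" "list_all (wf_fm S) \<Gamma>'"
    "\<And>x. wd_tm S (\<sigma> x) \<in> insert Truth (set \<Gamma>')"
  have variant: "variant (set \<Gamma>') (subst_fm \<sigma> (wd_tm S t)) (wd_tm S (subst_tm \<sigma> t))"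
    if "wf_tm S t" for t
    using that \<Gamma>'(3) by (rule variant_subst_wd_tm)
  have "provable S (subst_fm \<sigma> (wd_tm S l) # \<Gamma>') (subst_fm \<sigma> (wd_tm S r))"
    by (rule provable_subst[OF assms(5) \<sigma>])
      (use \<Gamma>' assms(3,7) \<sigma> in \<open>auto simp: wf_subst_fm wf_wd_tm\<close>)
  then have "provable S \<Gamma>' (subst_fm \<sigma> (wd_tm S r))"
    by (rule variant_hyp[OF variant[OF assms(3)], rotated]) (use \<Gamma>' assms(8) in auto)
  then show "provable S \<Gamma>' (wd_tm S (subst_tm \<sigma> r))"
    by (rule variant_goal[OF variant[OF assms(4)], rotated])
      (use assms(4) \<sigma> in \<open>auto simp: wf_wd_tm wf_subst_tm\<close>)
qed

lemma rewrite_at: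
  assumes wf: "wf_tm S l" "wf_fm S c" "wf_tm S r" "wf_tm S t"
    and p: "p \<in> positions t"
    and \<sigma>: "substitution S \<sigma>" "Dom \<sigma> \<subseteq> fv_tm l"
    and eq: "provable S [c] (Eq l r)" and wd: "provable S [c, wd_tm S l] (wd_tm S r)"
  shows "provable S [subst_fm \<sigma> c]
      (Eq (replace_at t p (subst_tm \<sigma> l)) (replace_at t p (subst_tm \<sigma> r)))" (is ?Eq)
    and "provable S [subst_fm \<sigma> c, wd_tm S (replace_at t p (subst_tm \<sigma> l))]
      (wd_tm S (replace_at t p (subst_tm \<sigma> r)))" (is ?WD)
proof -
  let ?l = "subst_tm \<sigma> l" and ?r = "subst_tm \<sigma> r" and ?c = "subst_fm \<sigma> c"
  let ?u = "replace_at t p ?l" and ?v = "replace_at t p ?r"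
  have "wf_tm S (\<sigma> x)" for x using \<sigma>(1) by (auto simp: substitution_def)
  then have wf': "wf_tm S ?l" "wf_tm S ?r" "wf_fm S ?c"
    using wf by (auto simp: wf_subst_tm wf_subst_fm)
  have wf_uv: "wf_tm S ?u" "wf_tm S ?v" using wf(4) p wf' by (auto intro: wf_replace_at)
  show ?WD
    by (rule wd_replace_at[where a = ?l and c = ?c])
      (use wf wf' wf_uv p in \<open>auto intro: rewrite_eq[OF \<sigma> eq] rewrite_wd[OF \<sigma> wf(1,3) wd]
        simp: wf_wd_tm\<close>)
  show ?Eq
  proof (rule provable.unfold, rule and_hyp_mem)
    let ?\<Gamma> = "map (wd_fm S) [?c] @ wd_fm S (Eq ?u ?v) # [?c]"
    let ?\<Gamma>' = "wd_tm S ?v # wd_tm S ?u # ?\<Gamma>"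
    show "And (wd_tm S ?u) (wd_tm S ?v) \<in> set ?\<Gamma>" by simp
    have wf_\<Gamma>: "list_all (wf_fm S) ?\<Gamma>'" using wf' wf_uv by (auto simp: wf_wd_fm wf_wd_tm)
    \<comment> \<open>The well-definedness of \<open>?u\<close> and \<open>?v\<close>, obtained by
      unfolding, passes to the subterms \<open>?l\<close> and \<open>?r\<close> at position
      \<open>p\<close>.\<close>
    have "provable S ?\<Gamma>' (wd_tm S s)" if "s = ?l \<or> s = ?r" for s
      by (rule wd_replace_at_hyp[OF _ _ p wf(4), of s])
        (use that wf_\<Gamma> wf' in \<open>auto intro!: provable.hyp simp: wf_wd_tm\<close>)
    moreover have "provable S ?\<Gamma>' (Eq ?l ?r)" by (rule rewrite_eq[OF \<sigma> eq wf_\<Gamma>]) simp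
    ultimately show "provable S ?\<Gamma>' (Eq ?u ?v)" by (blast intro: eq_replace_at[OF wf(4) p])
  qed
qed

end

theorem theorem1:
  fixes S :: "('f, 'p) signature"
    and l r t :: "'f tm" and c :: "('f, 'p) fm"
    and p :: "nat list" and \<sigma> :: "nat \<Rightarrow> 'f tm"
  assumes "wf_signature S"
    and "rewrite_rule S (l, c, r)"
    and "wf_tm S t"
    and "p \<in> positions t"
    and "substitution S \<sigma>"
    and "non_conflicting \<sigma>"
    and "Dom \<sigma> \<subseteq> fv_tm l"
    and "valid S (l, c, r)"
    and "wd_preserving S (l, c, r)"
  shows "provable S [subst_fm \<sigma> c]
           (Eq (replace_at t p (subst_tm \<sigma> l)) (replace_at t p (subst_tm \<sigma> r)))
       \<and> provable S [subst_fm \<sigma> c, wd_tm S (replace_at t p (subst_tm \<sigma> l))]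
           (wd_tm S (replace_at t p (subst_tm \<sigma> r)))"
  using assms by (auto intro!: rewrite_at[of S l c r])

end
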